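(* Let $m=2\bar m$ be even, let $\lambda_0,\lambda_1,\varepsilon\in\mathbb{R}$, and let $\mathfrak{M}_\varepsilon:=(\mathbb{R}^m,\lambda_0A_0+\lambda_1A_J+\varepsilon\mathcal{E})$. The eigenvalues of $\mathcal{J}(x)$ for $(x,x)=1$ are $\{0,\lambda_0+3\lambda_1,\lambda_0,\dots,\lambda_0\}$, where each eigenvalue is repeated according to multiplicity (so $\lambda_0$ is listed $m-2$ times). Thus $\mathfrak{M}_\varepsilon$ is an affine projective Osserman curvature model.
   Context: Let $(\cdot,\cdot)$ be the usual positive definite inner product on $\mathbb{R}^m$, and let $J$ be a Hermitian complex structure, i.e. $J$ is a linear endomorphism of $\mathbb{R}^m$ with $(Jx,Jy)=(x,y)$ and $J^2=-\operatorname{Id}$. Let $\{e_1,\dots,e_m\}$ be an orthonormal basis of $\mathbb{R}^m$ with $Je_{2j-1}=e_{2j}$ and $Je_{2j}=-e_{2j-1}$ for $1\le j\le\bar m$. Define $$A_0(x,y)z:=(y,z)x-(x,z)y,$$ $$A_J(x,y)z:=(Jy,z)Jx-(Jx,z)Jy-2(Jx,y)Jz,$$ and let $\mathcal{E}$ be the trilinear operator with $\mathcal{E}(e_1,e_2)e_1=-e_1$, $\mathcal{E}(e_2,e_1)e_2=e_2$, extended by the antisymmetry $\mathcal{E}(x,y)z=-\mathcal{E}(y,x)z$, with all other components $\mathcal{E}(e_i,e_j)e_k$ equal to zero. An affine curvature model $(V,A)$ is a finite-dimensional real vector space $V$ with a bilinear map $A:V\times V\to\operatorname{End}(V)$ such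 that $A(x,y)z=-A(y,x)z$ and $A(x,y)z+A(y,z)x+A(z,x)y=0$ for all $x,y,z\in V$. Its Jacobi operator is $\mathcal{J}(v)w:=A(w,v)v$; in the claim, $\mathcal{J}$ is the Jacobi operator of $\mathfrak{M}_\varepsilon$. For a linear map $T$ of a finite-dimensional real vector space, $\operatorname{Spec}\{T\}\subset\mathbb{C}$ is the set of complex roots of its characteristic polynomial; multiplicities are as roots of the characteristic polynomial. $(V,A)$ is an affine projective Osserman curvature model if for all non-zero $v,w\in V$ there is a real $s(v,w)\ne0$ with $\operatorname{Spec}\{\mathcal{J}(v)\}=s(v,w)\cdot\operatorname{Spec}\{\mathcal{J}(w)\}\ne\{0\}$.
   Formalization: The projective Osserman conclusion is stated only when the listed eigenvalues are not all zero (λ0+3λ1≠0, or m>2 and λ0≠0); otherwise Spec{J(v)}={0} for all v, e.g. λ0=λ1=0, and the claim is false. *)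

theory Defs
  imports
    "HOL-Analysis.Analysis"
    "HOL-Computational_Algebra.Polynomial"
begin

text \<open>
  A finite-dimensional real vector space is modelled as \<^typ>\<open>real ^ 'n\<close>, and a bilinear map into
  its endomorphisms as a curried function \<open>A x y z\<close> that is linear in \<open>z\<close>.
\<close>

definition affine_curvature_model :: "(real^'n \<Rightarrow> real^'n \<Rightarrow> real^'n \<Rightarrow> real^'n) \<Rightarrow> bool" where
  "affine_curvature_model A \<longleftrightarrow>
     (\<forall>x y. linear (A x y)) \<and>
     (\<forall>z. bilinear (\<lambda>x y. A x y z)) \<and>
     (\<forall>x y z. A x y z = - A y x z) \<and>
     (\<forall>x y z. A x y z + A y z x + A z x y = 0)"

definition jacobi_op :: "(real^'n \<Rightarrow> real^'n \<Rightarrow> real^'n \<Rightarrow> real^'n) \<Rightarrow> real^'n \<Rightarrow> real^'n \<Rightarrow> real^'n" where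
  "jacobi_op A v w = A w v v"

text \<open>The determinant of \<open>X I - M\<close> over the polynomial ring, where \<open>M\<close> is the matrix of \<open>T\<close> in the
  standard basis.\<close>

definition charpoly :: "(real^'n \<Rightarrow> real^'n) \<Rightarrow> real poly" where
  "charpoly T = det (mat [:0, 1:] - (\<chi> i j. [:matrix T $ i $ j:]))"

definition eigenvalues_mset :: "(real^'n \<Rightarrow> real^'n) \<Rightarrow> complex multiset" where
  "eigenvalues_mset T = proots (map_poly complex_of_real (charpoly T))"

definition Spec :: "(real^'n \<Rightarrow> real^'n) \<Rightarrow> complex set" where
  "Spec T = {z. poly (map_poly complex_of_real (charpoly T)) z = 0}"

definition affine_projective_Osserman :: "(real^'n \<Rightarrow> real^'n \<Rightarrow> real^'n \<Rightarrow> real^'n) \<Rightarrow> bool" where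
  "affine_projective_Osserman A \<longleftrightarrow>
     affine_curvature_model A \<and>
     (\<forall>v w. v \<noteq> 0 \<longrightarrow> w \<noteq> 0 \<longrightarrow>
        (\<exists>s::real. s \<noteq> 0 \<and>
           Spec (jacobi_op A v) = (\<lambda>z. complex_of_real s * z) ` Spec (jacobi_op A w) \<and>
           Spec (jacobi_op A v) \<noteq> {0}))"

definition hermitian_complex_structure :: "(real^'n \<Rightarrow> real^'n) \<Rightarrow> bool" where
  "hermitian_complex_structure J \<longleftrightarrow>
     linear J \<and> (\<forall>x y. J x \<bullet> J y = x \<bullet> y) \<and> (\<forall>x. J (J x) = - x)"

definition orthonormal_basis :: "(nat \<Rightarrow> real^'n) \<Rightarrow> bool" where
  "orthonormal_basis e \<longleftrightarrow>
     (\<forall>i\<in>{1..CARD('n)}. \<forall>j\<in>{1..CARD('n)}. e i \<bullet> e j = (if i = j then 1 else 0)) \<and>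
     span (e ` {1..CARD('n)}) = UNIV"

definition A_0 :: "real^'n \<Rightarrow> real^'n \<Rightarrow> real^'n \<Rightarrow> real^'n" where
  "A_0 x y z = (y \<bullet> z) *\<^sub>R x - (x \<bullet> z) *\<^sub>R y"

definition A_J :: "(real^'n \<Rightarrow> real^'n) \<Rightarrow> real^'n \<Rightarrow> real^'n \<Rightarrow> real^'n \<Rightarrow> real^'n" where
  "A_J J x y z = (J y \<bullet> z) *\<^sub>R J x - (J x \<bullet> z) *\<^sub>R J y - (2 * (J x \<bullet> y)) *\<^sub>R J z"

text \<open>The values on \<open>(e\<^sub>i, e\<^sub>j, e\<^sub>k)\<close>: the cases \<open>(1,2,1)\<close> and \<open>(2,1,2)\<close> are the prescribed ones,
  \<open>(2,1,1)\<close> and \<open>(1,2,2)\<close> are forced by antisymmetry in the first two arguments.\<close>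

definition E_comp :: "(nat \<Rightarrow> real^'n) \<Rightarrow> nat \<Rightarrow> nat \<Rightarrow> nat \<Rightarrow> real^'n" where
  "E_comp e i j k =
     (if (i, j, k) = (1, 2, 1) then - e 1
      else if (i, j, k) = (2, 1, 1) then e 1
      else if (i, j, k) = (2, 1, 2) then e 2
      else if (i, j, k) = (1, 2, 2) then - e 2
      else 0)"

definition E_op :: "(nat \<Rightarrow> real^'n) \<Rightarrow> real^'n \<Rightarrow> real^'n \<Rightarrow> real^'n \<Rightarrow> real^'n" where
  "E_op e x y z =
     (\<Sum>i=1..CARD('n). \<Sum>j=1..CARD('n). \<Sum>k=1..CARD('n).
        ((x \<bullet> e i) * (y \<bullet> e j) * (z \<bullet> e k)) *\<^sub>R E_comp e i j k)"

lemma E_op_basis: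
  fixes e :: "nat \<Rightarrow> real^'n"
  assumes "orthonormal_basis e"
    and "i \<in> {1..CARD('n)}" "j \<in> {1..CARD('n)}" "k \<in> {1..CARD('n)}"
  shows "E_op e (e i) (e j) (e k) = E_comp e i j k"
proof -
  have ip: "e a \<bullet> e b = (if a = b then 1 else 0)"
    if "a \<in> {1..CARD('n)}" "b \<in> {1..CARD('n)}" for a b
    using assms(1) that unfolding orthonormal_basis_def by blast
  have "E_op e (e i) (e j) (e k) =
     (\<Sum>a=1..CARD('n). \<Sum>b=1..CARD('n). \<Sum>c=1..CARD('n).
        (if i = a then if j = b then if k = c then E_comp e a b c else 0 else 0 else 0))"
    unfolding E_op_def using assms(2-4) by (intro sum.cong refl) (simp add: ip)
  also have "\<dots> = (\<Sum>a=1..CARD('n). if i = a then (\<Sum>b=1..CARD('n).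
      if j = b then (\<Sum>c=1..CARD('n). if k = c then E_comp e a b c else 0) else 0) else 0)"
    by (rule sum.cong[OF refl], rule if_split[THEN iffD2], intro conjI impI)
      (auto intro!: sum.cong simp del: sum.delta sum.delta')
  also have "\<dots> = E_comp e i j k"
    using assms(2-4) by simp
  finally show ?thesis .
qed

lemma E_op_antisym:
  fixes e :: "nat \<Rightarrow> real^'n"
  shows "E_op e x y z = - E_op e y x z"
proof -
  have c: "E_comp e i j k = - E_comp e j i k" for i j k
    by (auto simp: E_comp_def)
  have "E_op e x y z = (\<Sum>j=1..CARD('n). \<Sum>i=1..CARD('n). \<Sum>k=1..CARD('n).
      ((x \<bullet> e i) * (y \<bullet> e j) * (z \<bullet> e k)) *\<^sub>R E_comp e i j k)"
    unfolding E_op_def by (rule sum.swap)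
  also have "\<dots> = (\<Sum>j=1..CARD('n). \<Sum>i=1..CARD('n). \<Sum>k=1..CARD('n).
      - (((y \<bullet> e j) * (x \<bullet> e i) * (z \<bullet> e k)) *\<^sub>R E_comp e j i k))"
    by (intro sum.cong refl, subst c) (simp add: mult.commute)
  also have "\<dots> = - E_op e y x z"
    unfolding E_op_def by (simp add: sum_negf)
  finally show ?thesis .
qed

definition M_model ::
  "(nat \<Rightarrow> real^'n) \<Rightarrow> (real^'n \<Rightarrow> real^'n) \<Rightarrow> real \<Rightarrow> real \<Rightarrow> real \<Rightarrow>
   real^'n \<Rightarrow> real^'n \<Rightarrow> real^'n \<Rightarrow> real^'n" where
  "M_model e J l0 l1 \<epsilon> x y z =
     l0 *\<^sub>R A_0 x y z + l1 *\<^sub>R A_J J x y z + \<epsilon> *\<^sub>R E_op e x y z"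

end

theory Submission
  imports Defs
begin

text \<open>
  Write \<open>\<pi>\<close> for the orthogonal projection onto the plane spanned by \<open>e\<^sub>1, e\<^sub>2\<close>. The operator
  \<open>\<E>\<close> lives on this plane, and the Jacobi operator of the model is
  \<open>w \<mapsto> \<lambda>\<^sub>0 (v,v) w - \<lambda>\<^sub>0 (w,v) v + 3 \<lambda>\<^sub>1 (w,Jv) Jv + \<epsilon> (w,f) \<pi> v\<close>,
  where \<open>f = \<pi>(J v)\<close> is \<open>\<pi> v\<close> turned by a right angle inside the plane. Hence \<open>f\<close> is orthogonal
  to \<open>v\<close> and to \<open>\<pi> v\<close>, and \<open>J v\<close> is orthogonal to \<open>v\<close> and to \<open>\<pi> v\<close>.

  The \<open>\<epsilon>\<close>-term does not change the characteristic polynomial. To see this, start from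
  the scalar part of the characteristic matrix and add the remaining terms one by one; each has
  rank one, and adding \<open>(My) w\<^sup>T\<close> to a matrix \<open>M\<close> multiplies its determinant by \<open>1 + (y,w)\<close>
  (\<open>det_plus_outer\<close>). The terms in \<open>v\<close> and \<open>J v\<close> turn one eigenvalue \<open>\<lambda>\<^sub>0(v,v)\<close> into \<open>0\<close>
  and another one into \<open>(\<lambda>\<^sub>0 + 3\<lambda>\<^sub>1)(v,v)\<close>. For the last term the solution \<open>y\<close> is a combination
  of \<open>\<pi> v\<close> and \<open>v\<close>, hence orthogonal to \<open>f\<close>, and the factor is \<open>1\<close>. This is
  \<open>charpoly_rank_three\<close>. It gives the characteristic polynomial for every \<open>v\<close>
  (\<open>charpoly_jacobi_op_M_model\<close>); its roots are proportional to \<open>(v,v)\<close>, which is the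
  projective Osserman property with factor \<open>(v,v)/(w,w)\<close>.
\<close>

section \<open>Determinants under rank-one updates\<close>

definition outer :: "real^'n \<Rightarrow> real^'n \<Rightarrow> real^'n^'n" where
  "outer u w = (\<chi> i j. u $ i * w $ j)"

text \<open>
  Subtracting multiples of row \<open>k\<close> clears the multiples of \<open>w\<close> in the rows of \<open>S\<close>, which leaves
  the identity matrix with row \<open>k\<close> replaced by \<open>w\<close>. The determinant of that is Cramer's rule.
\<close>

lemma det_identity_replace_row:
  fixes u w :: "real^'n"
  assumes "finite S" "k \<notin> S"
  shows "det (\<chi> i. if i = k then w else if i \<in> S then axis i 1 + u $ i *s w else axis i 1) = w $ k"
  using assms
proof (induction S rule: finite_induct)
  case empty
  have rows: "row i (mat 1 :: real^'n^'n) = axis i 1" for i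
    by (simp add: row_def mat_def axis_def vec_eq_iff)
  show ?case
    using cramer_lemma_transpose[of k w "mat 1"] by (simp add: rows basis_expansion cong: if_cong)
next
  case (insert l S)
  then have "l \<noteq> k" by auto
  let ?B = "\<chi> i. if i = k then w else if i \<in> S then axis i 1 + u $ i *s w else axis i 1"
  have step: "(\<chi> i. if i = k then w else if i \<in> insert l S then axis i 1 + u $ i *s w else axis i 1)
      = (\<chi> i. if i = l then row l ?B + u $ l *s row k ?B else row i ?B)"
    using insert.hyps \<open>l \<noteq> k\<close> by (auto simp: vec_eq_iff row_def)
  have "det ?B = w $ k"
    using insert.IH insert.prems by blast
  then show ?case
    unfolding step det_row_operation[OF \<open>l \<noteq> k\<close>] .
qed

text \<open>
  The determinant is linear in each row. Turning row \<open>l\<close> of the identity into \<open>e\<^sub>l + u\<^sub>l w\<close>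
  therefore adds \<open>u\<^sub>l\<close> times a determinant of the kind computed in \<open>det_identity_replace_row\<close>,
  and this happens row by row.
\<close>

lemma det_identity_plus_outer:
  fixes u w :: "real^'n"
  shows "det (mat 1 + outer u w) = 1 + u \<bullet> w"
proof -
  have "det (\<chi> i. if i \<in> S then axis i 1 + u $ i *s w else axis i 1) = 1 + (\<Sum>i\<in>S. u $ i * w $ i)"
    if "finite S" for S
    using that
  proof (induction S rule: finite_induct)
    case empty
    have "(\<chi> i. axis i 1) = (mat 1 :: real^'n^'n)"
      by (simp add: mat_def axis_def vec_eq_iff eq_commute)
    then show ?case by simp
  next
    case (insert l S)
    let ?c = "\<lambda>i. if i \<in> S then axis i 1 + u $ i *s w else axis i 1"
    have "det (\<chi> i. if i \<in> insert l S then axis i 1 + u $ i *s w else axis i 1)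
        = det (\<chi> i. if i = l then axis i 1 + u $ l *s w else ?c i)"
      by (rule arg_cong[of _ _ det]) (auto simp: vec_eq_iff)
    also have "\<dots> = det (\<chi> i. if i = l then axis i 1 else ?c i) + u $ l * det (\<chi> i. if i = l then w else ?c i)"
      by (simp only: det_row_add det_row_mul)
    also have "(\<chi> i. if i = l then axis i 1 else ?c i) = (\<chi> i. ?c i)"
      using insert.hyps by (auto simp: vec_eq_iff)
    also have "det (\<chi> i. if i = l then w else ?c i) = w $ l"
      by (rule det_identity_replace_row) (use insert in auto)
    finally show ?case
      using insert by simp
  qed
  from this[of UNIV] have "det (\<chi> i. axis i 1 + u $ i *s w) = 1 + u \<bullet> w"
    by (simp add: inner_vec_def)
  also have "(\<chi> i. axis i 1 + u $ i *s w) = mat 1 + outer u w"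
    by (simp add: vec_eq_iff axis_def mat_def outer_def)
  finally show ?thesis .
qed

text \<open>
  The update factors as \<open>M (1 + y w\<^sup>T)\<close>. Prescribing a solution \<open>y\<close> of \<open>M y = u\<close> takes the place of
  inverting \<open>M\<close>.
\<close>

lemma det_plus_outer:
  fixes M :: "real^'n^'n"
  assumes "M *v y = u"
  shows "det (M + outer u w) = det M * (1 + y \<bullet> w)"
proof -
  have "M + outer u w = M ** (mat 1 + outer y w)"
    unfolding matrix_add_ldistrib matrix_mul_rid assms[symmetric]
    by (simp add: vec_eq_iff matrix_matrix_mult_def matrix_vector_mult_def outer_def
        sum_distrib_right mult.assoc)
  then show ?thesis
    by (simp add: det_mul det_identity_plus_outer)
qed

lemma outer_mult_vec [simp]: "outer u w *v x = (w \<bullet> x) *\<^sub>R u"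
  by (simp add: vec_eq_iff matrix_vector_mult_def outer_def inner_vec_def
      sum_distrib_left mult_ac)

lemma mat_mult_vec [simp]: "mat c *v (x::real^'n) = c *\<^sub>R x"
  by (simp add: vec_eq_iff matrix_vector_mult_def mat_def if_distrib[where f="\<lambda>x. x * _"] cong: if_cong)

lemma det_mat [simp]: "det (mat c :: real^'n^'n) = c ^ CARD('n)"
  by (subst det_diagonal) (auto simp: mat_def)

section \<open>The characteristic polynomial of a scalar plus three rank-one terms\<close>

lemma poly_charpoly: "poly (charpoly T) t = det (mat t - matrix T)"
  unfolding charpoly_def det_def
  by (simp add: poly_sum poly_prod mat_def)
    (intro sum.cong arg_cong2[where f="(*)"] prod.cong refl, auto)

lemma poly_eqI_cofinite:
  fixes p q :: "real poly"
  assumes "finite S" "\<And>t. t \<notin> S \<Longrightarrow> poly p t = poly q t"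
  shows "p = q"
proof (rule ccontr)
  assume "p \<noteq> q"
  then have "finite {t. poly (p - q) t = 0}"
    by (intro poly_roots_finite) simp
  moreover have "UNIV = S \<union> {t. poly (p - q) t = 0}"
    using assms(2) by auto
  ultimately show False
    using assms(1) infinite_UNIV_char_0[where 'a=real] by (metis finite_UnI)
qed

text \<open>
  The abstract shape of the Jacobi operators of the model. Since \<open>b (v,v) = a\<close>, the \<open>v\<close>-term moves
  one eigenvalue \<open>a\<close> to \<open>0\<close>, and the \<open>g\<close>-term moves one to \<open>a + c (g,g)\<close>. The \<open>p\<close>-term is a
  nilpotent perturbation that is strictly triangular for the flag
  \<open>span {v} \<subseteq> span {v, p}\<close>, so it leaves the characteristic polynomial alone.
\<close>

lemma charpoly_rank_three:
  fixes T :: "real^'n \<Rightarrow> real^'n" and v g f p :: "real^'n"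
  assumes T: "\<And>w. T w = a *\<^sub>R w - (b * (w \<bullet> v)) *\<^sub>R v + (c * (w \<bullet> g)) *\<^sub>R g + (w \<bullet> f) *\<^sub>R p"
    and a: "b * (v \<bullet> v) = a"
    and orth: "v \<bullet> g = 0" "g \<bullet> p = 0" "f \<bullet> v = 0" "f \<bullet> p = 0"
    and card: "2 \<le> CARD('n)"
  shows "charpoly T = [:0, 1:] * [:- (a + c * (g \<bullet> g)), 1:] * [:- a, 1:] ^ (CARD('n) - 2)"
\<comment> \<open>Away from \<open>t = a\<close> the scalar part is invertible, and \<open>t \<noteq> 0\<close> is needed to invert
  it once the \<open>v\<close>-term is added.\<close>
proof (rule poly_eqI_cofinite[of "{0, a}"])
  fix t assume "t \<notin> {0, a}"
  define s where "s = t - a"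
  have nz: "t \<noteq> 0" "s \<noteq> 0" using \<open>t \<notin> _\<close> by (auto simp: s_def)
  define M1 where "M1 = mat s + outer (b *\<^sub>R v) v"
  define M2 where "M2 = M1 + outer (- c *\<^sub>R g) g"
  have M: "mat t - matrix T = M2 + outer (- p) f"
    by (simp add: vec_eq_iff M2_def M1_def s_def matrix_def T outer_def mat_def inner_axis' algebra_simps)
      (auto simp: axis_def)
  have "det M1 = s ^ CARD('n) * (1 + (b / s) * (v \<bullet> v))"
    unfolding M1_def by (subst det_plus_outer[of _ "(b / s) *\<^sub>R v"]) (use nz in simp_all)
  moreover have "det M2 = det M1 * (1 - (c / s) * (g \<bullet> g))"
    unfolding M2_def
    by (subst det_plus_outer[of _ "(- c / s) *\<^sub>R g"])
      (use nz orth in \<open>simp_all add: M1_def matrix_vector_mult_add_rdistrib\<close>)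
  moreover have "det (M2 + outer (- p) f) = det M2"
  proof -
    \<comment> \<open>On \<open>span {v, p}\<close> the matrix \<open>M2\<close> multiplies by \<open>s\<close>, except that the \<open>v\<close>-term
      feeds into \<open>v\<close>; the multiple of \<open>v\<close> in \<open>y\<close> cancels that.\<close>
    define y where "y = - (1 / s) *\<^sub>R (p - (b * (v \<bullet> p) / t) *\<^sub>R v)"
    have k: "b * (v \<bullet> p) - (b * (v \<bullet> p) / t) * s - (b * (v \<bullet> p) / t) * (b * (v \<bullet> v)) = 0"
      using nz unfolding a by (simp add: s_def field_simps)
    have "M2 *v (p - (b * (v \<bullet> p) / t) *\<^sub>R v) = s *\<^sub>R p +
        (b * (v \<bullet> p) - (b * (v \<bullet> p) / t) * s - (b * (v \<bullet> p) / t) * (b * (v \<bullet> v))) *\<^sub>R v"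
      using orth by (simp add: M2_def M1_def matrix_vector_mult_add_rdistrib inner_diff_right inner_commute algebra_simps)
    then have "M2 *v (p - (b * (v \<bullet> p) / t) *\<^sub>R v) = s *\<^sub>R p"
      unfolding k by simp
    then have "M2 *v y = - p"
      using nz unfolding y_def matrix_vector_mult_scaleR by simp
    moreover have "y \<bullet> f = 0"
      using orth by (simp add: y_def inner_diff_right inner_commute[of _ f])
    ultimately show ?thesis
      by (simp add: det_plus_outer)
  qed
  ultimately have "det (mat t - matrix T) = s ^ CARD('n) * (1 + a / s) * (1 - c * (g \<bullet> g) / s)"
    using a by (simp add: M)
  also have "s ^ CARD('n) = s ^ (CARD('n) - 2) * s * s"
    using card by (metis le_add_diff_inverse2 power_add power2_eq_square mult.assoc)
  also have "\<dots> * (1 + a / s) * (1 - c * (g \<bullet> g) / s) =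
      s ^ (CARD('n) - 2) * (s * (1 + a / s)) * (s * (1 - c * (g \<bullet> g) / s))"
    by (simp only: mult_ac)
  also have "s * (1 + a / s) = t"
    using nz by (simp add: s_def field_simps)
  also have "s * (1 - c * (g \<bullet> g) / s) = t - (a + c * (g \<bullet> g))"
    using nz by (simp add: s_def field_simps)
  finally show "poly (charpoly T) t =
      poly ([:0, 1:] * [:- (a + c * (g \<bullet> g)), 1:] * [:- a, 1:] ^ (CARD('n) - 2)) t"
    unfolding poly_charpoly by (simp add: s_def algebra_simps)
qed simp

section \<open>Complex roots of a split real characteristic polynomial\<close>

lemma map_poly_of_real_mult:
  "map_poly complex_of_real (p * q) = map_poly complex_of_real p * map_poly complex_of_real q"
  by (rule poly_eqI) (simp add: coeff_map_poly coeff_mult)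

lemma map_poly_of_real_power:
  "map_poly complex_of_real (p ^ n) = map_poly complex_of_real p ^ n"
  by (induction n) (simp_all add: map_poly_of_real_mult)

lemma map_poly_of_real_linear:
  "map_poly complex_of_real [:c, 1:] = [:complex_of_real c, 1:]"
  by (simp add: map_poly_pCons)

lemma map_poly_split_charpoly:
  assumes "charpoly T = [:0, 1:] * [:- b, 1:] * [:- a, 1:] ^ k"
  shows "map_poly complex_of_real (charpoly T) =
      [:0, 1:] * [:- complex_of_real b, 1:] * [:- complex_of_real a, 1:] ^ k"
  unfolding assms map_poly_of_real_mult map_poly_of_real_power map_poly_of_real_linear by simp

lemma eigenvalues_mset_split_charpoly:
  assumes "charpoly T = [:0, 1:] * [:- b, 1:] * [:- a, 1:] ^ k"
  shows "eigenvalues_mset T = {#0, complex_of_real b#} + replicate_mset k (complex_of_real a)"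
  unfolding eigenvalues_mset_def map_poly_split_charpoly[OF assms]
  by (simp add: proots_mult proots_power del: mult_pCons_left mult_pCons_right)

lemma Spec_split_charpoly:
  assumes "charpoly T = [:0, 1:] * [:- b, 1:] * [:- a, 1:] ^ k"
  shows "Spec T = {0, complex_of_real b} \<union> (if k = 0 then {} else {complex_of_real a})"
  unfolding Spec_def map_poly_split_charpoly[OF assms] by auto

section \<open>The curvature model and its Jacobi operator\<close>

text \<open>
  \<open>\<E>(x,y)\<close> is the projection onto the plane of \<open>e\<^sub>1, e\<^sub>2\<close>, scaled by the signed area
  spanned by the projections of \<open>x\<close> and \<open>y\<close>; the first Bianchi identity for \<open>\<E>\<close> thus becomes the vanishing of
  alternating trilinear maps in two dimensions.
\<close>

lemma E_op_eq:
  fixes e :: "nat \<Rightarrow> real^'n"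
  assumes "2 \<le> CARD('n)"
  shows "E_op e x y z = ((x \<bullet> e 2) * (y \<bullet> e 1) - (x \<bullet> e 1) * (y \<bullet> e 2)) *\<^sub>R
    ((z \<bullet> e 1) *\<^sub>R e 1 + (z \<bullet> e 2) *\<^sub>R e 2)"
proof -
  have red: "(\<Sum>i=1..CARD('n). h i) = h 1 + h 2" if "\<And>i. i \<noteq> 1 \<Longrightarrow> i \<noteq> 2 \<Longrightarrow> h i = 0" for h :: "nat \<Rightarrow> real^'n"
  proof -
    have "(\<Sum>i=1..CARD('n). h i) = (\<Sum>i\<in>{1,2}. h i)"
      using assms that by (intro sum.mono_neutral_right) auto
    then show ?thesis by simp
  qed
  show ?thesis
    unfolding E_op_def
    by (subst red; (subst red)?; (subst red)?; simp add: E_comp_def algebra_simps)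
qed

lemma affine_curvature_model_M_model:
  fixes e :: "nat \<Rightarrow> real^'n"
  assumes "2 \<le> CARD('n)" "hermitian_complex_structure J"
  shows "affine_curvature_model (M_model e J l0 l1 \<epsilon>)"
proof -
  have J: "linear J" and skew: "J x \<bullet> y = - (J y \<bullet> x)" for x y
    using assms(2) by (auto simp: hermitian_complex_structure_def) (metis inner_commute inner_minus_left)
  note [simp] = linear_add[OF J] linear_scale[OF J]
  have M: "M_model e J l0 l1 \<epsilon> x y z = l0 *\<^sub>R A_0 x y z + l1 *\<^sub>R A_J J x y z +
     \<epsilon> *\<^sub>R (((x \<bullet> e 2) * (y \<bullet> e 1) - (x \<bullet> e 1) * (y \<bullet> e 2)) *\<^sub>R
    ((z \<bullet> e 1) *\<^sub>R e 1 + (z \<bullet> e 2) *\<^sub>R e 2))" for x y z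
    unfolding M_model_def E_op_eq[OF assms(1)] ..
  show ?thesis
    unfolding affine_curvature_model_def
  proof (intro conjI allI)
    show "linear (M_model e J l0 l1 \<epsilon> x y)" for x y
      by (rule linearI) (simp_all add: M A_0_def A_J_def inner_simps algebra_simps)
    show "bilinear (\<lambda>x y. M_model e J l0 l1 \<epsilon> x y z)" for z
      unfolding bilinear_def
      by (intro conjI allI linearI) (simp_all add: M A_0_def A_J_def inner_simps algebra_simps)
    show "M_model e J l0 l1 \<epsilon> x y z = - M_model e J l0 l1 \<epsilon> y x z" for x y z
      using skew[of x y] by (simp add: M A_0_def A_J_def algebra_simps)
    show "M_model e J l0 l1 \<epsilon> x y z + M_model e J l0 l1 \<epsilon> y z x + M_model e J l0 l1 \<epsilon> z x y = 0" for x y z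
    proof -
      have "A_0 x y z + A_0 y z x + A_0 z x y = 0"
        by (simp add: A_0_def inner_commute)
      moreover have "A_J J x y z + A_J J y z x + A_J J z x y = 0"
        using skew[of x y] skew[of y z] skew[of z x] by (simp add: A_J_def vec_eq_iff algebra_simps)
      moreover have "E_op e x y z + E_op e y z x + E_op e z x y = 0"
        unfolding E_op_eq[OF assms(1)] by (simp add: algebra_simps)
      ultimately show ?thesis
        unfolding M_model_def
        by (smt (verit) add.assoc add.commute scaleR_add_right scaleR_zero_right add.left_commute add_0)
    qed
  qed
qed

text \<open>
  \<open>charpoly_rank_three\<close> applies with \<open>g = J v\<close>, \<open>p = \<epsilon> \<pi> v\<close> and \<open>f\<close> the quarter turn of
  \<open>\<pi> v\<close> in the plane of \<open>e\<^sub>1, e\<^sub>2\<close>. That \<open>J\<close> preserves this plane is what makes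
  \<open>J v\<close> orthogonal to \<open>\<pi> v\<close>.
\<close>

lemma charpoly_jacobi_op_M_model:
  fixes e :: "nat \<Rightarrow> real^'n"
  assumes n: "2 \<le> CARD('n)" and herm: "hermitian_complex_structure J" and onb: "orthonormal_basis e"
    and Je: "J (e 1) = e 2" "J (e 2) = - e 1"
  shows "charpoly (jacobi_op (M_model e J l0 l1 \<epsilon>) v) =
    [:0, 1:] * [:- ((l0 + 3 * l1) * (v \<bullet> v)), 1:] * [:- (l0 * (v \<bullet> v)), 1:] ^ (CARD('n) - 2)"
proof -
  have iso: "J x \<bullet> J y = x \<bullet> y" and JJ: "J (J x) = - x" for x y
    using herm by (auto simp: hermitian_complex_structure_def)
  have skew: "x \<bullet> J y = - (J x \<bullet> y)" for x y
    by (metis JJ iso inner_minus_right minus_minus)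
  have e: "e 1 \<bullet> e 1 = 1" "e 2 \<bullet> e 2 = 1" "e 1 \<bullet> e 2 = 0"
    using onb n by (auto simp: orthonormal_basis_def)
  define f where "f = (v \<bullet> e 1) *\<^sub>R e 2 - (v \<bullet> e 2) *\<^sub>R e 1"
  define p where "p = (v \<bullet> e 1) *\<^sub>R e 1 + (v \<bullet> e 2) *\<^sub>R e 2"
  have "v \<bullet> J v = 0"
    using skew[of v v] by (simp add: inner_commute)
  have "charpoly (jacobi_op (M_model e J l0 l1 \<epsilon>) v) =
    [:0, 1:] * [:- (l0 * (v \<bullet> v) + 3 * l1 * (J v \<bullet> J v)), 1:] * [:- (l0 * (v \<bullet> v)), 1:] ^ (CARD('n) - 2)"
  proof (rule charpoly_rank_three)
    show "jacobi_op (M_model e J l0 l1 \<epsilon>) v w = (l0 * (v \<bullet> v)) *\<^sub>R w - (l0 * (w \<bullet> v)) *\<^sub>R v +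
        (3 * l1 * (w \<bullet> J v)) *\<^sub>R J v + (w \<bullet> f) *\<^sub>R (\<epsilon> *\<^sub>R p)" for w
      using \<open>v \<bullet> J v = 0\<close> skew[of w v]
      by (simp add: jacobi_op_def M_model_def A_0_def A_J_def E_op_eq[OF n] f_def p_def
          inner_commute[of "J v" v] inner_diff_right vec_eq_iff algebra_simps)
    show "J v \<bullet> \<epsilon> *\<^sub>R p = 0"
      using skew[of "e 1" v] skew[of "e 2" v]
      by (simp add: p_def Je inner_add_right inner_commute[of "J v"] inner_commute[of _ v] del: One_nat_def)
    show "f \<bullet> v = 0" "f \<bullet> \<epsilon> *\<^sub>R p = 0"
      using e by (simp_all add: f_def p_def inner_simps inner_commute)
  qed (use n \<open>v \<bullet> J v = 0\<close> in auto)
  then show ?thesis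
    by (simp add: iso algebra_simps)
qed

section \<open>The projective Osserman property\<close>

theorem lemma7p1:
  fixes e :: "nat \<Rightarrow> real^'n" and J :: "real^'n \<Rightarrow> real^'n"
    and mbar :: nat and l0 l1 \<epsilon> :: real
  assumes "CARD('n) = 2 * mbar"
    and "hermitian_complex_structure J"
    and "orthonormal_basis e"
    and "\<And>j. j \<in> {1..mbar} \<Longrightarrow> J (e (2 * j - 1)) = e (2 * j)"
    and "\<And>j. j \<in> {1..mbar} \<Longrightarrow> J (e (2 * j)) = - e (2 * j - 1)"
  shows "(\<forall>x. x \<bullet> x = 1 \<longrightarrow>
            eigenvalues_mset (jacobi_op (M_model e J l0 l1 \<epsilon>) x) =
              {#0, complex_of_real (l0 + 3 * l1)#} +
              replicate_mset (CARD('n) - 2) (complex_of_real l0)) \<and>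
         affine_curvature_model (M_model e J l0 l1 \<epsilon>) \<and>
         (l0 + 3 * l1 \<noteq> 0 \<or> (CARD('n) > 2 \<and> l0 \<noteq> 0) \<longrightarrow>
            affine_projective_Osserman (M_model e J l0 l1 \<epsilon>))"
proof -
  have "0 < CARD('n)"
    by (rule zero_less_card_finite)
  then have mbar: "1 \<le> mbar" and n: "2 \<le> CARD('n)"
    unfolding assms(1) by auto
  have Je: "J (e 1) = e 2" "J (e 2) = - e 1"
    using assms(4)[of 1] assms(5)[of 1] mbar by simp_all
  note curv = affine_curvature_model_M_model[OF n assms(2), of e l0 l1 \<epsilon>]
  note cp = charpoly_jacobi_op_M_model[OF n assms(2,3) Je, of l0 l1 \<epsilon>]
  note Spec = Spec_split_charpoly[OF cp]
  have "affine_projective_Osserman (M_model e J l0 l1 \<epsilon>)"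
    if nz: "l0 + 3 * l1 \<noteq> 0 \<or> (CARD('n) > 2 \<and> l0 \<noteq> 0)"
    unfolding affine_projective_Osserman_def
  proof (intro conjI allI impI curv)
    fix v w :: "real^'n" assume vw: "v \<noteq> 0" "w \<noteq> 0"
    let ?s = "(v \<bullet> v) / (w \<bullet> w)"
    have "Spec (jacobi_op (M_model e J l0 l1 \<epsilon>) v) =
        (\<lambda>z. complex_of_real ?s * z) ` Spec (jacobi_op (M_model e J l0 l1 \<epsilon>) w)"
      unfolding Spec using vw by auto
    moreover have "Spec (jacobi_op (M_model e J l0 l1 \<epsilon>) v) \<noteq> {0}"
    proof -
      have "complex_of_real ((l0 + 3 * l1) * (v \<bullet> v)) \<noteq> 0 \<or>
          (CARD('n) - 2 \<noteq> 0 \<and> complex_of_real (l0 * (v \<bullet> v)) \<noteq> 0)"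
        using nz vw by (auto simp del: of_real_add of_real_mult)
      then show ?thesis
        unfolding Spec by (auto split: if_splits)
    qed
    ultimately show "\<exists>s::real. s \<noteq> 0 \<and>
           Spec (jacobi_op (M_model e J l0 l1 \<epsilon>) v) =
             (\<lambda>z. complex_of_real s * z) ` Spec (jacobi_op (M_model e J l0 l1 \<epsilon>) w) \<and>
           Spec (jacobi_op (M_model e J l0 l1 \<epsilon>) v) \<noteq> {0}"
      using vw by (intro exI[of _ ?s]) simp
  qed
  moreover have "eigenvalues_mset (jacobi_op (M_model e J l0 l1 \<epsilon>) x) =
      {#0, complex_of_real (l0 + 3 * l1)#} + replicate_mset (CARD('n) - 2) (complex_of_real l0)"
    if "x \<bullet> x = 1" for x
    using eigenvalues_mset_split_charpoly[OF cp[of x]] that by simp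
  ultimately show ?thesis
    using curv by blast
qed

end
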